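(* For every $k\ge 2$, any deterministic $k$-way branching program computing $\mathrm{Children}^4_2(k)$ has at least $k^4/2$ states.
   Context: $T^4_2$ is the balanced rooted binary tree with 4 levels, nodes numbered heap-style: root $1$, children of $i$ are $2i,2i+1$. An input of $\mathrm{Children}^4_2(k)$ assigns to each internal node $i\neq 1$ a function $f_i:[k]^2\to[k]$ (given by its $k^2$ values, each a $k$-ary input variable $f_i(a,b)$) and to each leaf an element of $[k]=\{1,\dots,k\}$ (one variable each); there is no root function. Values: $v_i$ is the leaf label for a leaf and $v_i=f_i(v_{2i},v_{2i+1})$ for $i\in\{2,\dots,7\}$. The output is the pair $(v_2,v_3)\in[k]^2$. A deterministic $k$-way branching program computing $g:[k]^m\to R$ is a directed rooted multigraph of states; each nonfinal state is labelled by a variable index and has exactly $k$ outedges labelled $1,\dots,k$; $|R|$ final sink states are labelled by elements of $R$; on input $x$ the computation starts at the root, follows from a state labelled $j$ the edge labelled $x_j$, and must reach the final state labelled $g(x)$. *)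

theory Defs
  imports Complex_Main "HOL-Library.FuncSet"
begin

section \<open>Deterministic k-way branching programs\<close>

datatype ('v, 'r) state_label = Query 'v | Output 'r

text \<open>
  The outgoing edges of a state \<open>s\<close> are the pairs \<open>(s, a)\<close> with \<open>a \<in> {1..k}\<close>; the edge with
  label \<open>a\<close> leads to \<open>target B s a\<close>. This allows parallel edges and cycles. The function
  \<open>target B\<close> carries no meaning at states labelled \<open>Output r\<close>, which are sinks.
\<close>

record ('s, 'v, 'r) branching_program =
  states :: "'s set"
  root_state :: 's
  state_label :: "'s \<Rightarrow> ('v, 'r) state_label"
  target :: "'s \<Rightarrow> nat \<Rightarrow> 's"

text \<open>
  \<open>V\<close> is the set of (indices of) input variables, ranging over \<open>{1..k}\<close>, and \<open>R\<close> is the set of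
  possible results. Each element of \<open>R\<close> labels exactly one final state, so there are \<open>card R\<close>
  final states, and these count as states.
\<close>

definition kway_branching_program ::
    "nat \<Rightarrow> 'v set \<Rightarrow> 'r set \<Rightarrow> ('s, 'v, 'r) branching_program \<Rightarrow> bool" where
  "kway_branching_program k V R B \<longleftrightarrow>
     finite (states B) \<and>
     root_state B \<in> states B \<and>
     (\<forall>s\<in>states B. \<forall>v. state_label B s = Query v \<longrightarrow>
        v \<in> V \<and> (\<forall>a\<in>{1..k}. target B s a \<in> states B)) \<and>
     (\<forall>s\<in>states B. \<forall>r. state_label B s = Output r \<longrightarrow> r \<in> R) \<and>
     (\<forall>r\<in>R. \<exists>!s. s \<in> states B \<and> state_label B s = Output r)"

definition computation_step ::
    "('s, 'v, 'r) branching_program \<Rightarrow> ('v \<Rightarrow> nat) \<Rightarrow> 's \<Rightarrow> 's \<Rightarrow> bool" where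
  "computation_step B x s t \<longleftrightarrow> (\<exists>v. state_label B s = Query v \<and> t = target B s (x v))"

definition computes ::
    "nat \<Rightarrow> 'v set \<Rightarrow> 'r set \<Rightarrow> ('s, 'v, 'r) branching_program \<Rightarrow> (('v \<Rightarrow> nat) \<Rightarrow> 'r) \<Rightarrow> bool" where
  "computes k V R B g \<longleftrightarrow>
     kway_branching_program k V R B \<and>
     (\<forall>x \<in> V \<rightarrow>\<^sub>E {1..k}. \<exists>t\<in>states B.
        (computation_step B x)\<^sup>*\<^sup>* (root_state B) t \<and> state_label B t = Output (g x))"


section \<open>The Children problem on the binary tree with four levels\<close>

text \<open>
  Nodes are numbered heap-style: the root is \<open>1\<close>, the other internal nodes are \<open>2..7\<close> and the
  leaves are \<open>8..15\<close>. \<open>FunVar i a b\<close> is the variable holding \<open>f\<^sub>i(a, b)\<close>.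
\<close>

datatype tree_var = LeafVar nat | FunVar nat nat nat

definition children_vars :: "nat \<Rightarrow> tree_var set" where
  "children_vars k =
     {LeafVar i | i. i \<in> {8..15}} \<union>
     {FunVar i a b | i a b. i \<in> {2..7} \<and> a \<in> {1..k} \<and> b \<in> {1..k}}"

text \<open>The value of \<open>node_value x i\<close> is only meaningful for \<open>i \<in> {2..15}\<close>.\<close>

function node_value :: "(tree_var \<Rightarrow> nat) \<Rightarrow> nat \<Rightarrow> nat" where
  "node_value x i =
     (if i \<in> {2..7}
      then x (FunVar i (node_value x (2 * i)) (node_value x (2 * i + 1)))
      else x (LeafVar i))"
  by auto
termination
  by (relation "measure (\<lambda>(x, i). 8 - i)") auto

declare node_value.simps [simp del]

definition children :: "(tree_var \<Rightarrow> nat) \<Rightarrow> nat \<times> nat" where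
  "children x = (node_value x 2, node_value x 3)"

end

theory Submission
  imports Defs
begin

text \<open>
  Restrict to the inputs where every even leaf carries \<open>a\<close>, every odd leaf carries \<open>b\<close>, both
  \<open>f\<^sub>2\<close> and \<open>f\<^sub>3\<close> are addition modulo \<open>k\<close>, and \<open>f\<^sub>i(a, b) = w\<^sub>i\<close> is the only entry of \<open>f\<^sub>i\<close>
  that matters for \<open>i = 4, ..., 7\<close>. The output depends on each \<open>w\<^sub>i\<close>, so every
  computation queries one of the variables \<open>f\<^sub>i(a, b)\<close>; consider the state \<open>s\<close> of the last such
  query. Its label reveals \<open>a\<close>, \<open>b\<close> and \<open>i\<close>, and from \<open>s\<close> on the computation depends on \<open>w\<close> only
  through \<open>w\<^sub>i\<close>. Hence \<open>s\<close> and \<open>w\<^sub>i\<close> determine the output, that is, the sums modulo \<open>k\<close> of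
  \<open>w\<^sub>4, w\<^sub>5\<close> and of \<open>w\<^sub>6, w\<^sub>7\<close>. One more value \<open>w\<^sub>j\<close>, from the pair not containing \<open>i\<close>, determines
  all of \<open>w\<close>. So the \<open>k\<^sup>6\<close> inputs inject into pairs of a state and two values, and there are at
  least \<open>k\<^sup>4\<close> states.
\<close>

section \<open>Computations of branching programs\<close>

text \<open>Induction from the front of the path: a last visit found in the tail stays the last one;
  if the tail has none, the first state decides. Only sources of steps must avoid \<open>P\<close>,
  so \<open>t\<close> itself is unconstrained.\<close>

lemma rtranclp_last_visit:
  assumes "R\<^sup>*\<^sup>* s t"
  shows "(\<lambda>u v. R u v \<and> \<not> P u)\<^sup>*\<^sup>* s t \<or>
    (\<exists>u u'. R\<^sup>*\<^sup>* s u \<and> P u \<and> R u u' \<and> (\<lambda>u v. R u v \<and> \<not> P u)\<^sup>*\<^sup>* u' t)"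
  using assms
proof (induction rule: converse_rtranclp_induct)
  case base
  then show ?case by simp
next
  case (step y z)
  from step.IH show ?case
  proof
    assume av: "(\<lambda>u v. R u v \<and> \<not> P u)\<^sup>*\<^sup>* z t"
    show ?thesis
    proof (cases "P y")
      case True
      with av step.hyps(1) show ?thesis by blast
    next
      case False
      with step.hyps(1) av show ?thesis
        by (intro disjI1) (rule converse_rtranclp_into_rtranclp[where b = z], auto)
    qed
  next
    assume "\<exists>u u'. R\<^sup>*\<^sup>* z u \<and> P u \<and> R u u' \<and> (\<lambda>u v. R u v \<and> \<not> P u)\<^sup>*\<^sup>* u' t"
    with step.hyps(1) show ?thesis
      by (meson converse_rtranclp_into_rtranclp)
  qed
qed

text \<open>Determinism leaves a single path from \<open>s\<close>, and it cannot continue past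
  \<open>t\<close>, so \<open>u\<close> lies on it no later than \<open>t\<close>.\<close>

lemma rtranclp_deterministic_terminal:
  assumes det: "\<And>u v v'. R u v \<Longrightarrow> R u v' \<Longrightarrow> v = v'"
    and "R\<^sup>*\<^sup>* s u" "R\<^sup>*\<^sup>* s t" and terminal: "\<And>v. \<not> R t v"
  shows "R\<^sup>*\<^sup>* u t"
  using assms(2,3)
proof (induction rule: rtranclp_induct)
  case base
  then show ?case .
next
  case (step y z)
  then have "R\<^sup>*\<^sup>* y t" by blast
  then show ?case
    using step.hyps(2) det terminal by (metis converse_rtranclpE)
qed

lemma computation_step_deterministic:
  "computation_step B x s t \<Longrightarrow> computation_step B x s t' \<Longrightarrow> t = t'"
  by (auto simp: computation_step_def)

lemma not_computation_step_Output:
  "state_label B s = Output r \<Longrightarrow> \<not> computation_step B x s t"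
  by (auto simp: computation_step_def)

lemma computation_in_states:
  assumes "kway_branching_program k V R B" "x \<in> V \<rightarrow> {1..k}"
    and "(computation_step B x)\<^sup>*\<^sup>* (root_state B) s"
  shows "s \<in> states B"
  using assms(3)
proof (induction rule: rtranclp_induct)
  case base
  then show ?case using assms(1) by (simp add: kway_branching_program_def)
next
  case (step y z)
  then obtain v where v: "state_label B y = Query v" "z = target B y (x v)"
    by (auto simp: computation_step_def)
  with step assms(1) have "v \<in> V \<and> (\<forall>a\<in>{1..k}. target B y a \<in> states B)"
    by (auto simp: kway_branching_program_def)
  with v assms(2) show ?case by auto
qed

section \<open>The last query to a set of variables\<close>

definition queries_in :: "('s, 'v, 'r) branching_program \<Rightarrow> 'v set \<Rightarrow> 's \<Rightarrow> bool" where
  "queries_in B C s \<longleftrightarrow> (\<exists>v\<in>C. state_label B s = Query v)"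

definition last_query ::
    "('s, 'v, 'r) branching_program \<Rightarrow> 'v set \<Rightarrow> ('v \<Rightarrow> nat) \<Rightarrow> 'v \<Rightarrow> 's \<Rightarrow> 'r \<Rightarrow> bool" where
  "last_query B C x v s r \<longleftrightarrow>
     (computation_step B x)\<^sup>*\<^sup>* (root_state B) s \<and> state_label B s = Query v \<and> v \<in> C \<and>
     (\<exists>t. (\<lambda>u u'. computation_step B x u u' \<and> \<not> queries_in B C u)\<^sup>*\<^sup>* (target B s (x v)) t \<and>
       state_label B t = Output r)"

lemma computation_avoiding_cong:
  assumes "(\<lambda>u u'. computation_step B x u u' \<and> \<not> queries_in B C u)\<^sup>*\<^sup>* s t"
    and "\<And>v. v \<notin> C \<Longrightarrow> x v = y v"
  shows "(computation_step B y)\<^sup>*\<^sup>* s t"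
proof (rule rtranclp_mono[THEN predicate2D, OF _ assms(1)], rule predicate2I)
  fix u u'
  assume "computation_step B x u u' \<and> \<not> queries_in B C u"
  then show "computation_step B y u u'"
    using assms(2) by (fastforce simp: computation_step_def queries_in_def)
qed

lemma computes_output_unique:
  assumes "computes k V R B g" "x \<in> V \<rightarrow>\<^sub>E {1..k}"
    and "(computation_step B x)\<^sup>*\<^sup>* (root_state B) t" "state_label B t = Output r"
  shows "g x = r"
proof -
  obtain t' where t': "(computation_step B x)\<^sup>*\<^sup>* (root_state B) t'" "state_label B t' = Output (g x)"
    using assms(1,2) by (auto simp: computes_def)
  have "(computation_step B x)\<^sup>*\<^sup>* t t'"
    by (rule rtranclp_deterministic_terminal[OF computation_step_deterministic assms(3) t'(1)
          not_computation_step_Output[OF t'(2)]])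
  then have "t = t'"
    using not_computation_step_Output[OF assms(4)] by (metis converse_rtranclpE)
  with t'(2) assms(4) show ?thesis by simp
qed

text \<open>If the computation on \<open>x\<close> never queried \<open>C\<close>, then
  \<open>y\<close> would follow the same path to the same output, against
  \<open>neq\<close>.\<close>

lemma ex_last_query:
  assumes B: "computes k V R B g" and x: "x \<in> V \<rightarrow>\<^sub>E {1..k}" and y: "y \<in> V \<rightarrow>\<^sub>E {1..k}"
    and xy: "\<And>v. v \<notin> C \<Longrightarrow> x v = y v" and neq: "g x \<noteq> g y"
  shows "\<exists>v s. last_query B C x v s (g x)"
proof -
  obtain t where t: "(computation_step B x)\<^sup>*\<^sup>* (root_state B) t" "state_label B t = Output (g x)"
    using B x by (auto simp: computes_def)
  let ?A = "\<lambda>u u'. computation_step B x u u' \<and> \<not> queries_in B C u"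
  have "\<not> ?A\<^sup>*\<^sup>* (root_state B) t"
  proof
    assume "?A\<^sup>*\<^sup>* (root_state B) t"
    then have "(computation_step B y)\<^sup>*\<^sup>* (root_state B) t"
      using xy by (rule computation_avoiding_cong)
    from computes_output_unique[OF B y this t(2)] neq show False by simp
  qed
  then obtain u u' where u: "(computation_step B x)\<^sup>*\<^sup>* (root_state B) u" "queries_in B C u"
      "computation_step B x u u'" "?A\<^sup>*\<^sup>* u' t"
    using rtranclp_last_visit[OF t(1), of "queries_in B C"] by blast
  then obtain v where "v \<in> C" "state_label B u = Query v" "u' = target B u (x v)"
    by (auto simp: queries_in_def computation_step_def)
  with u t(2) show ?thesis by (auto simp: last_query_def)
qed

text \<open>The computations may reach \<open>s\<close> by different paths. From \<open>s\<close>
  on, \<open>x\<close> reads only \<open>v\<close> and variables outside \<open>C\<close>, where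
  \<open>y\<close> has the same values, so \<open>y\<close> takes the same continuation.\<close>

lemma last_query_output_cong:
  assumes B: "computes k V R B g" and y: "y \<in> V \<rightarrow>\<^sub>E {1..k}"
    and x_last: "last_query B C x v s r" and y_reach: "(computation_step B y)\<^sup>*\<^sup>* (root_state B) s"
    and xy: "\<And>u. u \<notin> C \<Longrightarrow> x u = y u" and v: "x v = y v"
  shows "g y = r"
proof -
  obtain t where t: "(\<lambda>u u'. computation_step B x u u' \<and> \<not> queries_in B C u)\<^sup>*\<^sup>* (target B s (x v)) t"
      "state_label B t = Output r" and s: "state_label B s = Query v"
    using x_last by (auto simp: last_query_def)
  have "computation_step B y s (target B s (x v))"
    using s v by (auto simp: computation_step_def)
  with y_reach computation_avoiding_cong[OF t(1) xy]
  have "(computation_step B y)\<^sup>*\<^sup>* (root_state B) t"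
    by (meson rtranclp.rtrancl_into_rtrancl rtranclp_trans)
  then show ?thesis using computes_output_unique[OF B y _ t(2)] by blast
qed

section \<open>The hard inputs\<close>

text \<open>The \<open>+ 1\<close> moves residues into \<open>{1..k}\<close>. The value
  \<open>1\<close> at the remaining entries is an arbitrary default.\<close>

definition hard_input :: "nat \<Rightarrow> nat \<Rightarrow> nat \<Rightarrow> (nat \<Rightarrow> nat) \<Rightarrow> tree_var \<Rightarrow> nat" where
  "hard_input k a b w = restrict (\<lambda>v. case v of
       LeafVar i \<Rightarrow> if even i then a else b
     | FunVar i p q \<Rightarrow>
         if i \<in> {2, 3} then (p + q) mod k + 1
         else if p = a \<and> q = b then w i else 1) (children_vars k)"

definition critical_vars :: "nat \<Rightarrow> nat \<Rightarrow> tree_var set" where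
  "critical_vars a b = (\<lambda>i. FunVar i a b) ` {4..7}"

lemma hard_input_in:
  assumes "a \<in> {1..k}" "b \<in> {1..k}" "w \<in> {4..7} \<rightarrow> {1..k}"
  shows "hard_input k a b w \<in> children_vars k \<rightarrow>\<^sub>E {1..k}"
proof -
  have w: "w i \<in> {1..k}" if "i \<in> {2..7}" "i \<noteq> 2" "i \<noteq> 3" for i
    using assms(3) that by (intro funcset_mem[of w]) auto
  have "0 < k" using assms by auto
  then have "Suc (n mod k) \<le> k" for n by (simp add: Suc_leI)
  then show ?thesis
    using assms(1,2) w
    by (auto simp: hard_input_def children_vars_def split: if_splits)
qed

lemma hard_input_eq_off_critical:
  assumes "v \<notin> critical_vars a b"
  shows "hard_input k a b w v = hard_input k a b w' v"
proof (cases "v \<in> children_vars k")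
  case True
  then show ?thesis
  proof (cases v)
    case (FunVar i p q)
    with True have "i \<in> {2, 3} \<or> i \<in> {4..7}" by (auto simp: children_vars_def)
    with assms FunVar have "i \<in> {2, 3} \<or> \<not> (p = a \<and> q = b)"
      by (auto simp: critical_vars_def)
    with FunVar show ?thesis by (auto simp: hard_input_def restrict_def)
  qed (simp add: hard_input_def)
qed (simp add: hard_input_def)

lemma hard_input_critical:
  assumes "a \<in> {1..k}" "b \<in> {1..k}" "i \<in> {4..7}"
  shows "hard_input k a b w (FunVar i a b) = w i"
  using assms by (auto simp: hard_input_def children_vars_def)

lemma children_hard_input:
  assumes a: "a \<in> {1..k}" "b \<in> {1..k}" "w \<in> {4..7} \<rightarrow> {1..k}"
  shows "children (hard_input k a b w) = ((w 4 + w 5) mod k + 1, (w 6 + w 7) mod k + 1)"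
proof -
  let ?x = "hard_input k a b w"
  have leaf: "node_value ?x i = (if even i then a else b)" if "i \<in> {8..15}" for i
    using that by (subst node_value.simps) (auto simp: hard_input_def children_vars_def)
  \<comment> \<open>The children of such a node are an even and an odd leaf, so its function is
    evaluated at \<open>(a, b)\<close>.\<close>
  have mid: "node_value ?x i = w i" if "i \<in> {4..7}" for i
    using that leaf[of "2 * i"] leaf[of "2 * i + 1"] hard_input_critical[OF a(1,2) that]
    by (subst node_value.simps) auto
  have w: "w i \<in> {1..k}" if "i \<in> {4..7}" for i using a(3) that by auto
  have "node_value ?x i = (w (2 * i) + w (2 * i + 1)) mod k + 1" if i: "i \<in> {2, 3}" for i
  proof -
    have m: "2 * i \<in> {4..7}" "2 * i + 1 \<in> {4..7}" using i by auto
    have "FunVar i (w (2 * i)) (w (2 * i + 1)) \<in> children_vars k"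
      using i w[OF m(1)] w[OF m(2)] by (auto simp: children_vars_def)
    moreover have "i \<in> {2..7}" using i by auto
    ultimately show ?thesis
      using i mid[OF m(1)] mid[OF m(2)]
      by (subst node_value.simps) (auto simp: hard_input_def)
  qed
  from this[of 2] this[of 3] show ?thesis by (simp add: children_def)
qed

text \<open>\<open>{1..k}\<close> contains each residue modulo \<open>k\<close> exactly once:
  \<open>k\<close> divides the difference, which is smaller than \<open>k\<close>.\<close>

lemma mod_add_right_cancel_range:
  fixes u v c k :: nat
  assumes "u \<in> {1..k}" "v \<in> {1..k}" "(u + c) mod k = (v + c) mod k"
  shows "u = v"
  using assms
proof (induction u v rule: linorder_wlog)
  case (le u v)
  then have "k dvd v - u"
    by (metis add_le_cancel_right diff_cancel2 mod_eq_dvd_iff_nat)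
  moreover have "v - u < k" using le by auto
  ultimately show ?case using le by (metis dvd_imp_le diff_is_0_eq le_antisym not_le zero_less_iff_neq_zero)
next
  case (sym u v)
  then show ?case by metis
qed

lemma ex_last_query_hard_input:
  assumes k: "k \<ge> 2" and B: "computes k (children_vars k) R B children"
    and a: "a \<in> {1..k}" "b \<in> {1..k}" and w: "w \<in> {4..7} \<rightarrow> {1..k}"
  shows "\<exists>i\<in>{4..7}. \<exists>s. last_query B (critical_vars a b) (hard_input k a b w) (FunVar i a b) s
    (children (hard_input k a b w))"
proof -
  \<comment> \<open>Since \<open>k \<ge> 2\<close>, there is a second value for \<open>w 4\<close>;
    changing \<open>w 4\<close> alone changes the first output.\<close>
  define c where "c = (if w 4 = 1 then 2 else 1 :: nat)"
  have c: "c \<in> {1..k}" "c \<noteq> w 4" using k by (auto simp: c_def)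
  then have w': "w(4 := c) \<in> {4..7} \<rightarrow> {1..k}" using w by auto
  have "w 4 \<in> {1..k}" using w by auto
  then have "(w 4 + w 5) mod k \<noteq> (c + w 5) mod k"
    using c mod_add_right_cancel_range by metis
  then have "children (hard_input k a b w) \<noteq> children (hard_input k a b (w(4 := c)))"
    by (simp add: children_hard_input[OF a w] children_hard_input[OF a w'])
  then have "\<exists>v s. last_query B (critical_vars a b) (hard_input k a b w) v s
      (children (hard_input k a b w))"
    by (intro ex_last_query[OF B hard_input_in[OF a w] hard_input_in[OF a w']]
        hard_input_eq_off_critical)
  then obtain v s where vs: "last_query B (critical_vars a b) (hard_input k a b w) v s
      (children (hard_input k a b w))"
    by blast
  then have "v \<in> critical_vars a b" by (simp add: last_query_def)
  then obtain i where "i \<in> {4..7}" "v = FunVar i a b" by (auto simp: critical_vars_def)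
  with vs show ?thesis by blast
qed

section \<open>The injection and the count\<close>

theorem theorem5p8:
  fixes k :: nat and B :: "('s, tree_var, nat \<times> nat) branching_program"
  assumes "k \<ge> 2"
    and "computes k (children_vars k) ({1..k} \<times> {1..k}) B children"
  shows "real (card (states B)) \<ge> real k ^ 4 / 2"
proof -
  \<comment> \<open>Extensionality makes the four values determine \<open>w\<close>, so that
    \<open>W\<close> has \<open>k ^ 4\<close> elements.\<close>
  define W where "W = {4..7::nat} \<rightarrow>\<^sub>E {1..k}"
  define T where "T = ({1..k} \<times> {1..k}) \<times> W"
  define last where "last = (\<lambda>((a, b), w) (i, s). i \<in> {4..7} \<and>
    last_query B (critical_vars a b) (hard_input k a b w) (FunVar i a b) s
      (children (hard_input k a b w)))"
  have "\<exists>p. last \<tau> p" if "\<tau> \<in> T" for \<tau>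
  proof -
    obtain a b w where \<tau>: "\<tau> = ((a, b), w)" by (metis surj_pair)
    with that have "a \<in> {1..k}" "b \<in> {1..k}" "w \<in> {4..7} \<rightarrow> {1..k}"
      by (auto simp: T_def W_def)
    from ex_last_query_hard_input[OF assms this] show ?thesis
      by (auto simp: last_def \<tau>)
  qed
  then obtain p where p: "\<And>\<tau>. \<tau> \<in> T \<Longrightarrow> last \<tau> (p \<tau>)" by metis
  \<comment> \<open>A representative of whichever of the pairs 4, 5 and 6, 7 does not contain
    \<open>i\<close>.\<close>
  define other where "other = (\<lambda>i::nat. if i \<le> 5 then 6 else 4 :: nat)"
  define F where "F = (\<lambda>\<tau>. (snd (p \<tau>), snd \<tau> (fst (p \<tau>)), snd \<tau> (other (fst (p \<tau>)))))"
  have kw: "kway_branching_program k (children_vars k) ({1..k} \<times> {1..k}) B"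
    using assms(2) by (simp add: computes_def)
  have fin: "finite (states B)" using kw by (simp add: kway_branching_program_def)
  have "F ` T \<subseteq> states B \<times> {1..k} \<times> {1..k}"
  proof
    fix z assume "z \<in> F ` T"
    then obtain \<tau> where \<tau>: "\<tau> \<in> T" "z = F \<tau>" by blast
    obtain a b w where abw: "\<tau> = ((a, b), w)" by (metis surj_pair)
    obtain i s where ps: "p ((a, b), w) = (i, s)" by (metis surj_pair)
    have mem: "a \<in> {1..k}" "b \<in> {1..k}" "w \<in> {4..7} \<rightarrow> {1..k}"
      using \<tau>(1) by (auto simp: abw T_def W_def)
    from p[OF \<tau>(1)] have "last ((a, b), w) (i, s)" by (simp add: abw ps)
    then have i: "i \<in> {4..7}"
      and s: "(computation_step B (hard_input k a b w))\<^sup>*\<^sup>* (root_state B) s"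
      by (simp_all add: last_def last_query_def)
    have "s \<in> states B"
      using computation_in_states[OF kw _ s] hard_input_in[OF mem] by auto
    moreover have "other i \<in> {4..7}" by (auto simp: other_def)
    ultimately show "z \<in> states B \<times> {1..k} \<times> {1..k}"
      using i mem(3) by (auto simp: \<tau>(2) F_def abw ps)
  qed
  moreover have "inj_on F T"
  proof (rule inj_onI)
    fix \<tau> \<tau>' assume \<tau>: "\<tau> \<in> T" and \<tau>': "\<tau>' \<in> T" and eq: "F \<tau> = F \<tau>'"
    obtain a b w where abw: "\<tau> = ((a, b), w)" by (metis surj_pair)
    obtain a' b' w' where abw': "\<tau>' = ((a', b'), w')" by (metis surj_pair)
    obtain i s where ps: "p ((a, b), w) = (i, s)" by (metis surj_pair)
    obtain i' s' where ps': "p ((a', b'), w') = (i', s')" by (metis surj_pair)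
    have w: "w \<in> W" and w': "w' \<in> W" using \<tau> \<tau>' by (auto simp: T_def abw abw')
    have l: "i \<in> {4..7}" "last_query B (critical_vars a b) (hard_input k a b w) (FunVar i a b) s
      (children (hard_input k a b w))"
      using p[OF \<tau>] by (simp_all add: abw ps last_def)
    have l': "last_query B (critical_vars a' b') (hard_input k a' b' w') (FunVar i' a' b') s'
      (children (hard_input k a' b' w'))"
      using p[OF \<tau>'] by (simp add: abw' ps' last_def)
    have "F \<tau> = (s, w i, w (other i))" "F \<tau>' = (s', w' i', w' (other i'))"
      by (simp_all add: F_def abw abw' ps ps')
    with eq have coords: "s = s'" "w i = w' i'" "w (other i) = w' (other i')" by simp_all
    then have "s' = s" by simp
    \<comment> \<open>A state has one label, and the label \<open>Query (FunVar i a b)\<close>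
      spells out all three numbers.\<close>
    with l(2) l' have same: "i' = i" "a' = a" "b' = b" by (auto simp: last_query_def)
    have wi: "w i = w' i" "w (other i) = w' (other i)"
      using coords same by simp_all
    have mem: "a \<in> {1..k}" "b \<in> {1..k}" "w \<in> {4..7} \<rightarrow> {1..k}" "w' \<in> {4..7} \<rightarrow> {1..k}"
      using \<tau> w w' by (auto simp: abw T_def W_def)
    \<comment> \<open>Both inputs pass through \<open>s\<close>, and they agree off the critical
      variables and, by \<open>wi\<close>, at the variable queried in \<open>s\<close>.\<close>
    have "children (hard_input k a b w') = children (hard_input k a b w)"
    proof (rule last_query_output_cong[OF assms(2) hard_input_in[OF mem(1,2,4)] l(2)])
      show "(computation_step B (hard_input k a b w'))\<^sup>*\<^sup>* (root_state B) s"
        using l' by (simp add: last_query_def same \<open>s' = s\<close>)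
      show "hard_input k a b w (FunVar i a b) = hard_input k a b w' (FunVar i a b)"
        by (simp add: hard_input_critical[OF mem(1,2) l(1)] wi(1))
    qed (rule hard_input_eq_off_critical)
    then have sums: "(w 4 + w 5) mod k = (w' 4 + w' 5) mod k" "(w 6 + w 7) mod k = (w' 6 + w' 7) mod k"
      by (simp_all add: children_hard_input[OF mem(1,2,3)] children_hard_input[OF mem(1,2,4)])
    have rng: "w j \<in> {1..k}" "w' j \<in> {1..k}" if "j \<in> {4..7}" for j using mem(3,4) that by auto
    have pair: "w j = w' j \<longleftrightarrow> w m = w' m"
      if "(w j + w m) mod k = (w' j + w' m) mod k" "j \<in> {4..7}" "m \<in> {4..7}" for j m
    proof
      assume "w j = w' j"
      with that(1) show "w m = w' m"
        by (intro mod_add_right_cancel_range[OF rng[OF that(3)], of "w j"]) (simp add: add.commute)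
    next
      assume "w m = w' m"
      with that(1) show "w j = w' j"
        by (intro mod_add_right_cancel_range[OF rng[OF that(2)], of "w m"]) simp
    qed
    have p45: "w 4 = w' 4 \<longleftrightarrow> w 5 = w' 5" and p67: "w 6 = w' 6 \<longleftrightarrow> w 7 = w' 7"
      using pair[OF sums(1)] pair[OF sums(2)] by simp_all
    \<comment> \<open>One value in each pair is now known to agree: \<open>w i\<close> in its own
      pair, \<open>w (other i)\<close> in the opposite one. The sums give the partners.\<close>
    have "i = 4 \<or> i = 5 \<or> i = 6 \<or> i = 7" using l(1) by auto
    then have "w 4 = w' 4" "w 5 = w' 5" "w 6 = w' 6" "w 7 = w' 7"
      using wi p45 p67 by (auto simp: other_def)
    moreover have "{4..7::nat} = {4, 5, 6, 7}" by auto
    ultimately have "w j = w' j" if "j \<in> {4..7}" for j using that by auto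
    with w w' have "w = w'" unfolding W_def by (rule PiE_ext)
    then show "\<tau> = \<tau>'" by (simp add: abw abw' same)
  qed
  ultimately have "card T \<le> card (states B \<times> {1..k} \<times> {1..k})"
    using fin by (intro card_inj_on_le[of F]) auto
  \<comment> \<open>\<open>k\<^sup>2\<close> choices of leaf values times \<open>k ^ 4\<close>
    choices of \<open>w\<close>; the two recorded values cost a factor \<open>k\<^sup>2\<close>,
    which cancels below.\<close>
  moreover have "card T = k ^ 4 * k\<^sup>2"
    by (simp add: T_def W_def card_cartesian_product card_PiE power2_eq_square)
  ultimately have "k ^ 4 * k\<^sup>2 \<le> card (states B) * k\<^sup>2"
    by (simp add: card_cartesian_product power2_eq_square)
  then have "k ^ 4 \<le> card (states B)"
    by (rule mult_right_le_imp_le) (use assms(1) in simp)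
  then have "real k ^ 4 \<le> real (card (states B))" by (metis of_nat_le_iff of_nat_power)
  \<comment> \<open>The count yields \<open>k ^ 4\<close> itself; nonnegativity passes to the weaker
    half.\<close>
  moreover have "real k ^ 4 \<ge> 0" by simp
  ultimately show ?thesis by linarith
qed

end
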